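(* Let $(u,v)$ be a nonnegative classical solution of the Neumann problem $$\begin{cases}\Delta[(d_1+a_{11}u)u]+u(1-u-a_1v)=0, & x\in\Omega,\\ \Delta[(d_2+a_{22}v)v]+v(1-a_2u-v)=0, & x\in\Omega,\\ \dfrac{\partial u}{\partial\nu}=\dfrac{\partial v}{\partial\nu}=0, & x\in\partial\Omega.\end{cases}$$ If $u\not\equiv0$, then $u\le1$ in $\overline\Omega$. Similarly, if $v\not\equiv0$, then $v\le1$ in $\overline\Omega$.
   Context: $\Omega\subset\mathbb{R}^n$ ($n\ge1$) is a bounded domain with smooth boundary satisfying the interior ball condition at every boundary point, and $\nu$ is the outward unit normal on $\partial\Omega$. The constants satisfy $a_1,a_2,d_1,d_2>0$ and $a_{11},a_{22}\ge0$. A nonnegative classical solution is a pair $(u,v)\in (C^1(\overline\Omega)\cap C^2(\Omega))^2$ with $u,v\ge0$ in $\overline\Omega$ satisfying the system (equations and boundary conditions) pointwise. *)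

theory Defs
  imports "HOL-Analysis.Analysis"
begin

definition partial_deriv :: "'a::euclidean_space \<Rightarrow> ('a \<Rightarrow> real) \<Rightarrow> 'a \<Rightarrow> real" where
  "partial_deriv b f x = frechet_derivative f (at x) b"

definition gradient :: "('a::euclidean_space \<Rightarrow> real) \<Rightarrow> 'a \<Rightarrow> 'a" where
  "gradient f x = (\<Sum>b\<in>Basis. partial_deriv b f x *\<^sub>R b)"

definition laplacian :: "('a::euclidean_space \<Rightarrow> real) \<Rightarrow> 'a \<Rightarrow> real" where
  "laplacian f x = (\<Sum>b\<in>Basis. partial_deriv b (partial_deriv b f) x)"

text \<open>The class $C^k(S)$. Only meaningful for open \<open>S\<close>, since derivatives are full derivatives at
  the points of \<open>S\<close>.\<close>

primrec Ck_on :: "nat \<Rightarrow> 'a::euclidean_space set \<Rightarrow> ('a \<Rightarrow> real) \<Rightarrow> bool" where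
  "Ck_on 0 S f \<longleftrightarrow> continuous_on S f"
| "Ck_on (Suc k) S f \<longleftrightarrow>
     (\<forall>x\<in>S. f differentiable (at x)) \<and> (\<forall>b\<in>Basis. Ck_on k S (partial_deriv b f))"

definition smooth_on :: "'a::euclidean_space set \<Rightarrow> ('a \<Rightarrow> real) \<Rightarrow> bool" where
  "smooth_on S f \<longleftrightarrow> (\<forall>k. Ck_on k S f)"

text \<open>The class $C^1(\overline\Omega)$ for open \<open>\<Omega>\<close>: \<open>f\<close> is continuous on the closure, $C^1$ inside, and
  its first derivatives extend continuously to the closure.\<close>

definition C1_on_closure :: "'a::euclidean_space set \<Rightarrow> ('a \<Rightarrow> real) \<Rightarrow> bool" where
  "C1_on_closure \<Omega> f \<longleftrightarrow>
     continuous_on (closure \<Omega>) f \<and> Ck_on 1 \<Omega> f \<and>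
     (\<exists>g. continuous_on (closure \<Omega>) g \<and> (\<forall>x\<in>\<Omega>. g x = gradient f x))"

definition bounded_domain :: "'a::euclidean_space set \<Rightarrow> bool" where
  "bounded_domain \<Omega> \<longleftrightarrow> open \<Omega> \<and> connected \<Omega> \<and> \<Omega> \<noteq> {} \<and> bounded \<Omega>"

text \<open>A smooth local defining function near a boundary point: \<open>\<Omega>\<close> is locally the sublevel set
  \<open>\<rho> < 0\<close> with \<open>0\<close> a regular value, so that the boundary is locally the smooth hypersurface
  \<open>\<rho> = 0\<close> and \<open>\<Omega>\<close> lies on one side of it. By the implicit function theorem this is the same as
  \<open>\<Omega>\<close> being locally the region on one side of the graph of a smooth function.\<close>

definition local_defining_function ::
    "'a::euclidean_space set \<Rightarrow> 'a \<Rightarrow> 'a set \<Rightarrow> ('a \<Rightarrow> real) \<Rightarrow> bool" where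
  "local_defining_function \<Omega> x U \<rho> \<longleftrightarrow>
     open U \<and> x \<in> U \<and> smooth_on U \<rho> \<and>
     \<Omega> \<inter> U = {y \<in> U. \<rho> y < 0} \<and>
     frontier \<Omega> \<inter> U = {y \<in> U. \<rho> y = 0} \<and>
     (\<forall>y\<in>frontier \<Omega> \<inter> U. gradient \<rho> y \<noteq> 0)"

definition smooth_boundary :: "'a::euclidean_space set \<Rightarrow> bool" where
  "smooth_boundary \<Omega> \<longleftrightarrow> (\<forall>x\<in>frontier \<Omega>. \<exists>U \<rho>. local_defining_function \<Omega> x U \<rho>)"

text \<open>The normalised gradient at \<open>x\<close> is the same for all local defining functions.\<close>

definition outward_unit_normal :: "'a::euclidean_space set \<Rightarrow> 'a \<Rightarrow> 'a \<Rightarrow> bool" where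
  "outward_unit_normal \<Omega> x n \<longleftrightarrow>
     (\<exists>U \<rho>. local_defining_function \<Omega> x U \<rho> \<and> n = gradient \<rho> x /\<^sub>R norm (gradient \<rho> x))"

definition interior_ball_condition :: "'a::euclidean_space set \<Rightarrow> 'a \<Rightarrow> bool" where
  "interior_ball_condition \<Omega> x \<longleftrightarrow> (\<exists>y r. 0 < r \<and> ball y r \<subseteq> \<Omega> \<and> x \<in> sphere y r)"

text \<open>On the boundary the gradient of a $C^1(\overline\Omega)$ function is the value of its
  continuous extension from the interior; values of \<open>f\<close> off the closure play no role.\<close>

definition normal_derivative ::
    "'a::euclidean_space set \<Rightarrow> ('a \<Rightarrow> 'a) \<Rightarrow> ('a \<Rightarrow> real) \<Rightarrow> 'a \<Rightarrow> real" where
  "normal_derivative \<Omega> \<nu> f x = Lim (at x within \<Omega>) (gradient f) \<bullet> \<nu> x"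

end

theory Submission
  imports Defs
begin

text \<open>Suppose \<open>u\<close> attains a maximum \<open>M > 1\<close> over the closure. Near the maximum point the equation gives
  \<open>\<Delta>w \<ge> c > 0\<close> for \<open>w = (d + a u) u\<close>, which is an increasing function of \<open>u \<ge> 0\<close>. This excludes an
  interior maximum. At a boundary maximum \<open>x\<close>, Hopf's lemma has a shortcut because \<open>\<Delta>w\<close> is bounded below
  by a positive constant: on a small ball inside the domain touching the boundary at \<open>x\<close> the paraboloid
  \<open>w x - \<kappa> (s\<^sup>2 - |z - y|\<^sup>2)\<close> lies above \<open>w\<close>, so \<open>w\<close>, and hence \<open>u\<close>, decreases at least linearly along
  the inward normal, contradicting the Neumann condition.\<close>

section \<open>Directional derivatives\<close>

lemma gradient_inner:
  fixes f :: "'a::euclidean_space \<Rightarrow> real"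
  assumes "f differentiable (at x)"
  shows "gradient f x \<bullet> h = frechet_derivative f (at x) h"
proof -
  have lin: "linear (frechet_derivative f (at x))"
    using assms by (simp add: linear_frechet_derivative)
  have "frechet_derivative f (at x) h
      = frechet_derivative f (at x) (\<Sum>b\<in>Basis. (h \<bullet> b) *\<^sub>R b)"
    by (simp add: euclidean_representation)
  also have "\<dots> = (\<Sum>b\<in>Basis. (h \<bullet> b) * frechet_derivative f (at x) b)"
    using lin by (simp add: linear_sum linear_scale)
  also have "\<dots> = gradient f x \<bullet> h"
    by (simp add: gradient_def partial_deriv_def inner_sum_left inner_commute[of h] mult.commute)
  finally show ?thesis by simp
qed

lemma has_real_derivative_along_line:
  fixes f :: "'a::euclidean_space \<Rightarrow> real"
  assumes "f differentiable (at (x + t *\<^sub>R h))"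
  shows "((\<lambda>s. f (x + s *\<^sub>R h)) has_real_derivative gradient f (x + t *\<^sub>R h) \<bullet> h) (at t)"
proof -
  have f: "(f has_derivative frechet_derivative f (at (x + t *\<^sub>R h))) (at (x + t *\<^sub>R h))"
    using assms by (simp add: frechet_derivative_works)
  have line: "((\<lambda>s. x + s *\<^sub>R h) has_derivative (\<lambda>s. s *\<^sub>R h)) (at t)"
    by (auto intro!: derivative_eq_intros)
  have "((\<lambda>s. f (x + s *\<^sub>R h)) has_derivative
      (\<lambda>s. frechet_derivative f (at (x + t *\<^sub>R h)) (s *\<^sub>R h))) (at t)"
    using diff_chain_at[OF line f] by (simp add: o_def)
  moreover have "(\<lambda>s. frechet_derivative f (at (x + t *\<^sub>R h)) (s *\<^sub>R h))
      = (*) (gradient f (x + t *\<^sub>R h) \<bullet> h)"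
    using linear_frechet_derivative[OF assms]
    by (auto simp: linear_scale gradient_inner[OF assms] mult.commute)
  ultimately show ?thesis
    by (simp add: has_field_derivative_def)
qed

lemma gradient_inner_Basis:
  assumes "b \<in> Basis"
  shows "gradient f x \<bullet> b = partial_deriv b f x"
  using assms by (simp add: gradient_def inner_sum_left inner_Basis if_distrib sum.delta cong: if_cong)

section \<open>Second-order tests and comparison with paraboloids\<close>

lemma second_derivative_nonpos_at_local_max:
  fixes \<phi> \<phi>' :: "real \<Rightarrow> real"
  assumes "e > 0"
    and der: "\<And>t. \<bar>t\<bar> < e \<Longrightarrow> (\<phi> has_real_derivative \<phi>' t) (at t)"
    and der2: "(\<phi>' has_real_derivative D) (at 0)"
    and max: "\<And>t. \<bar>t\<bar> < e \<Longrightarrow> \<phi> t \<le> \<phi> 0"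
  shows "D \<le> 0"
proof (rule ccontr)
  assume "\<not> D \<le> 0"
  have "\<phi>' 0 = 0"
    using DERIV_local_max[OF der[of 0], of e] max \<open>e > 0\<close> by auto
  \<comment> \<open>If \<open>D > 0\<close>, then \<open>\<phi>'\<close> rises from 0 and is
    positive just to the right, so the mean value theorem makes \<open>\<phi>\<close> exceed its
    maximum.\<close>
  then obtain d where d: "d > 0" "\<And>h. 0 < h \<Longrightarrow> h < d \<Longrightarrow> \<phi>' h > 0"
    using DERIV_pos_inc_right[OF der2] \<open>\<not> D \<le> 0\<close> by auto
  define t where "t = min d e / 2"
  have t: "0 < t" "t < d" "t < e"
    using d(1) \<open>e > 0\<close> by (auto simp: t_def)
  obtain z where z: "0 < z" "z < t" "\<phi> t - \<phi> 0 = (t - 0) * \<phi>' z"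
    using MVT2[of 0 t \<phi> \<phi>'] der t by auto
  have "\<phi>' z > 0" using d(2) z t by auto
  then have "\<phi> t > \<phi> 0" using z t by (smt (verit) mult_pos_pos)
  then show False using max[of t] t by auto
qed

text \<open>Along each coordinate line through \<open>x\<close> the second-derivative test bounds
  the pure second derivative of \<open>f\<close> by that of the paraboloid, \<open>2 * k\<close>;
  summing gives the trace. The case \<open>k = 0\<close> is the usual test at an interior
  maximum.\<close>

lemma laplacian_le_at_max_minus_paraboloid:
  fixes f :: "'a::euclidean_space \<Rightarrow> real"
  assumes "open S" "x \<in> S"
    and diff: "\<And>z. z \<in> S \<Longrightarrow> f differentiable (at z)"
    and diff2: "\<And>b. b \<in> Basis \<Longrightarrow> partial_deriv b f differentiable (at x)"
    and max: "\<And>z. z \<in> S \<Longrightarrow> f z - k * (dist z y)\<^sup>2 \<le> f x - k * (dist x y)\<^sup>2"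
  shows "laplacian f x \<le> 2 * k * real DIM('a)"
proof -
  obtain e where e: "e > 0" "ball x e \<subseteq> S"
    using assms(1,2) open_contains_ball by blast
  have "partial_deriv b (partial_deriv b f) x \<le> 2 * k" if b: "b \<in> Basis" for b
  proof -
    define \<phi> where "\<phi> t = f (x + t *\<^sub>R b) - k * ((x - y + t *\<^sub>R b) \<bullet> (x - y + t *\<^sub>R b))" for t
    define \<phi>' where "\<phi>' t = partial_deriv b f (x + t *\<^sub>R b) - k * (2 * ((x - y) \<bullet> b) + 2 * t)" for t
    have bb: "b \<bullet> b = 1" using b by simp
    have inS: "x + t *\<^sub>R b \<in> S" if "\<bar>t\<bar> < e" for t
      using that e(2) b by (auto simp: dist_norm)
    \<comment> \<open>As \<open>b\<close> is a unit vector, this is a quadratic in \<open>t\<close>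
      with leading coefficient 1, which is where the \<open>2 * k\<close> comes from.\<close>
    have quad: "(x - y + t *\<^sub>R b) \<bullet> (x - y + t *\<^sub>R b)
        = (x - y) \<bullet> (x - y) + 2 * ((x - y) \<bullet> b) * t + t\<^sup>2" for t
      using bb by (simp only: inner_add_left inner_add_right inner_scaleR_left inner_scaleR_right)
        (simp add: inner_commute power2_eq_square algebra_simps)
    have "partial_deriv b (partial_deriv b f) x - 2 * k \<le> 0"
    proof (rule second_derivative_nonpos_at_local_max[OF e(1)])
      fix t :: real assume t: "\<bar>t\<bar> < e"
      note [derivative_intros] =
        has_real_derivative_along_line[OF diff[OF inS[OF t]], unfolded gradient_inner_Basis[OF b]]
      show "(\<phi> has_real_derivative \<phi>' t) (at t)"
        unfolding \<phi>_def \<phi>'_def quad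
        by (auto intro!: derivative_eq_intros simp: algebra_simps)
      have "\<phi> s = f (x + s *\<^sub>R b) - k * (dist (x + s *\<^sub>R b) y)\<^sup>2" for s
        by (simp add: \<phi>_def dist_norm power2_norm_eq_inner algebra_simps)
      then show "\<phi> t \<le> \<phi> 0"
        using max[OF inS[OF t]] by simp
    next
      have "partial_deriv b f differentiable (at (x + 0 *\<^sub>R b))"
        using diff2[OF b] by simp
      from has_real_derivative_along_line[OF this]
      have [derivative_intros]: "((\<lambda>s. partial_deriv b f (x + s *\<^sub>R b)) has_real_derivative
          partial_deriv b (partial_deriv b f) x) (at 0)"
        by (simp add: gradient_inner_Basis[OF b])
      show "(\<phi>' has_real_derivative partial_deriv b (partial_deriv b f) x - 2 * k) (at 0)"
        unfolding \<phi>'_def by (auto intro!: derivative_eq_intros)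
    qed
    then show ?thesis by simp
  qed
  then have "laplacian f x \<le> (\<Sum>b\<in>(Basis::'a set). 2 * k)"
    unfolding laplacian_def by (intro sum_mono)
  then show ?thesis by (simp add: mult.commute)
qed

text \<open>The strict inequality on the Laplacian keeps the maximum of \<open>f\<close> minus the
  paraboloid out of the open ball, so it lies on the sphere, where \<open>f\<close> is at most
  \<open>m\<close> and the distance to \<open>y\<close> is \<open>s\<close>.\<close>

lemma paraboloid_bound_on_ball:
  fixes f :: "'a::euclidean_space \<Rightarrow> real"
  assumes cont: "continuous_on (cball y s) f"
    and diff: "\<And>z. z \<in> ball y s \<Longrightarrow> f differentiable (at z)"
    and diff2: "\<And>z b. z \<in> ball y s \<Longrightarrow> b \<in> Basis \<Longrightarrow> partial_deriv b f differentiable (at z)"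
    and lap: "\<And>z. z \<in> ball y s \<Longrightarrow> laplacian f z > 2 * k * real DIM('a)"
    and bound: "\<And>z. z \<in> sphere y s \<Longrightarrow> f z \<le> m"
    and z: "z \<in> cball y s"
  shows "f z \<le> m - k * (s\<^sup>2 - (dist z y)\<^sup>2)"
proof -
  have "continuous_on (cball y s) (\<lambda>z. f z - k * (dist z y)\<^sup>2)"
    using cont by (intro continuous_intros)
  then obtain p where p: "p \<in> cball y s"
      "\<And>z. z \<in> cball y s \<Longrightarrow> f z - k * (dist z y)\<^sup>2 \<le> f p - k * (dist p y)\<^sup>2"
    using continuous_attains_sup[OF compact_cball] z by (metis (no_types, lifting) empty_iff)
  have "p \<notin> ball y s"
  proof
    assume "p \<in> ball y s"
    then have "laplacian f p \<le> 2 * k * real DIM('a)"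
      using diff diff2 p(2)
      by (intro laplacian_le_at_max_minus_paraboloid[OF open_ball, where y = y]) auto
    with lap[OF \<open>p \<in> ball y s\<close>] show False by simp
  qed
  then have "dist p y = s" "f p \<le> m"
    using p(1) bound[of p] by (auto simp: dist_commute)
  with p(2)[OF z] show ?thesis by (simp add: algebra_simps)
qed

section \<open>Boundary geometry and the normal derivative\<close>

text \<open>Every direction from \<open>x\<close> into the ball is a direction in which \<rho>
  cannot increase to first order. These directions fill an open half-space, so the gradient of
  \<rho> must be a positive multiple of the radius vector.\<close>

lemma outward_unit_normal_interior_ball:
  fixes \<Omega> :: "'a::euclidean_space set"
  assumes normal: "outward_unit_normal \<Omega> x n"
    and "x \<in> frontier \<Omega>" "r > 0" "ball y r \<subseteq> \<Omega>" "x \<in> sphere y r"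
  shows "x - y = r *\<^sub>R n"
proof -
  obtain U \<rho> where U: "local_defining_function \<Omega> x U \<rho>"
    and n: "n = gradient \<rho> x /\<^sub>R norm (gradient \<rho> x)"
    using normal by (auto simp: outward_unit_normal_def)
  have oU: "open U" "x \<in> U" and neg: "\<And>z. z \<in> \<Omega> \<Longrightarrow> z \<in> U \<Longrightarrow> \<rho> z < 0" and "\<rho> x = 0"
    and g0: "gradient \<rho> x \<noteq> 0" and "smooth_on U \<rho>"
    using U \<open>x \<in> frontier \<Omega>\<close> unfolding local_defining_function_def by blast+
  then have "Ck_on (Suc 0) U \<rho>" by (simp only: smooth_on_def)
  then have diff: "\<rho> differentiable (at x)" using oU by simp
  define g e where "g = gradient \<rho> x" and "e = x - y"
  have e: "norm e = r" using \<open>x \<in> sphere y r\<close> by (simp add: e_def dist_norm norm_minus_commute)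
  \<comment> \<open>For small \<open>t > 0\<close> the point \<open>x + t *\<^sub>R h\<close> is in
    the ball, by expanding the squared norm of \<open>e + t *\<^sub>R h\<close>, so \<rho> is
    negative there; \<open>g \<bullet> h > 0\<close> would make it positive.\<close>
  have into: "g \<bullet> h \<le> 0" if h: "h \<bullet> e < 0" for h
  proof (rule ccontr)
    assume "\<not> g \<bullet> h \<le> 0"
    have "((\<lambda>t. \<rho> (x + t *\<^sub>R h)) has_real_derivative g \<bullet> h) (at 0)"
      using has_real_derivative_along_line[of \<rho> x 0 h] diff by (simp add: g_def)
    from DERIV_pos_inc_right[OF this] obtain d where
      d: "d > 0" "\<And>t. 0 < t \<Longrightarrow> t < d \<Longrightarrow> \<rho> (x + t *\<^sub>R h) > 0"
      using \<open>\<not> g \<bullet> h \<le> 0\<close> \<open>\<rho> x = 0\<close> by auto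
    have "((\<lambda>t. x + t *\<^sub>R h) \<longlongrightarrow> x + 0 *\<^sub>R h) (at_right 0)"
      by (intro tendsto_intros)
    then have inU: "\<forall>\<^sub>F t in at_right 0. x + t *\<^sub>R h \<in> U"
      using oU topological_tendstoD by fastforce
    have "((\<lambda>t. 2 * (h \<bullet> e) + t * (h \<bullet> h)) \<longlongrightarrow> 2 * (h \<bullet> e) + 0 * (h \<bullet> h)) (at_right 0)"
      by (intro tendsto_intros)
    then have quad: "\<forall>\<^sub>F t in at_right 0. 2 * (h \<bullet> e) + t * (h \<bullet> h) < 0"
      by (rule order_tendstoD(2)) (use h in simp)
    have "\<forall>\<^sub>F t in at_right (0::real). 0 < t \<and> t < d"
      using d(1) eventually_at_right_field by blast
    with inU quad have "\<forall>\<^sub>F t in at_right (0::real). False"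
    proof eventually_elim
      case (elim t)
      have "(norm (e + t *\<^sub>R h))\<^sup>2 = (norm e)\<^sup>2 + t * (2 * (h \<bullet> e) + t * (h \<bullet> h))"
        by (simp only: power2_norm_eq_inner inner_add_left inner_add_right inner_scaleR_left
            inner_scaleR_right) (simp add: inner_commute algebra_simps)
      also have "\<dots> < r\<^sup>2" using elim e by (simp add: mult_pos_neg)
      finally have "norm (e + t *\<^sub>R h) < r"
        by (rule power2_less_imp_less) (use \<open>r > 0\<close> in simp)
      then have "x + t *\<^sub>R h \<in> ball y r"
        by (simp add: e_def dist_norm norm_minus_commute[of y] algebra_simps)
      then have "\<rho> (x + t *\<^sub>R h) < 0" using neg elim assms(4) by blast
      with d(2)[of t] elim show False by auto
    qed
    then show False by simp
  qed
  have ee: "e \<bullet> e > 0" using e \<open>r > 0\<close> by auto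
  have ge: "g \<bullet> e \<ge> 0" using into[of "- e"] ee by simp
  \<comment> \<open>This \<open>c\<close> makes \<open>g - c *\<^sub>R e\<close> orthogonal to
    \<open>e\<close>. Such a direction is only on the edge of the half-space in \<open>into\<close>,
    so it is tilted inward by \<open>\<delta> *\<^sub>R e\<close> and \<delta> is sent to 0. The
    result says that the squared norm of \<open>g - c *\<^sub>R e\<close> is at most 0.\<close>
  define c where "c = (g \<bullet> e) / (e \<bullet> e)"
  have lim: "((\<lambda>\<delta>. g \<bullet> (g - c *\<^sub>R e - \<delta> *\<^sub>R e)) \<longlongrightarrow> g \<bullet> (g - c *\<^sub>R e - 0 *\<^sub>R e)) (at_right 0)"
    by (intro tendsto_intros)
  have ce: "c * (e \<bullet> e) = g \<bullet> e" using ee by (simp add: c_def)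
  have "g \<bullet> (g - c *\<^sub>R e - \<delta> *\<^sub>R e) \<le> 0" if "\<delta> > 0" for \<delta>
    using that ee ce by (intro into) (simp add: inner_diff_left)
  then have "g \<bullet> (g - c *\<^sub>R e - 0 *\<^sub>R e) \<le> 0"
    by (intro tendsto_upperbound[OF lim]) (auto simp: eventually_at_right_less eventually_at_filter)
  moreover have "(g - c *\<^sub>R e) \<bullet> (g - c *\<^sub>R e) = g \<bullet> (g - c *\<^sub>R e)"
    using ce by (simp add: inner_diff_left inner_diff_right inner_commute)
  ultimately have g: "g = c *\<^sub>R e"
    by (metis diff_zero eq_iff_diff_eq_0 inner_ge_zero inner_eq_zero_iff antisym scaleR_zero_left)
  have "c > 0" using g g0 ge ee by (auto simp: g_def[symmetric] c_def less_le)
  then have "n = e /\<^sub>R r"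
    using n e by (simp add: g_def[symmetric] g)
  then show ?thesis using \<open>r > 0\<close> by (simp add: e_def)
qed

text \<open>By the mean value theorem the difference quotient along the inward normal is a value of
  \<open>gradient f\<close> in direction \<open>\<nu> x\<close> at an interior point. These values
  tend to the normal derivative 0, hence drop below \<open>k\<close> near \<open>x\<close>.\<close>

lemma no_linear_decrease_along_normal:
  fixes f :: "'a::euclidean_space \<Rightarrow> real"
  assumes "open \<Omega>" and x: "x \<in> frontier \<Omega>" and f: "C1_on_closure \<Omega> f"
    and "normal_derivative \<Omega> \<nu> f x = 0" and norm: "norm (\<nu> x) = 1"
    and "s > 0" "k > 0"
    and inside: "\<And>t. 0 < t \<Longrightarrow> t < s \<Longrightarrow> x - t *\<^sub>R \<nu> x \<in> \<Omega>"
    and decrease: "\<And>t. 0 < t \<Longrightarrow> t < s \<Longrightarrow> k * t \<le> f x - f (x - t *\<^sub>R \<nu> x)"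
  shows False
proof -
  have cl: "x \<in> closure \<Omega>" and "x \<notin> \<Omega>"
    using x \<open>open \<Omega>\<close> by (auto simp: frontier_def interior_open)
  obtain g where g: "continuous_on (closure \<Omega>) g" "\<And>z. z \<in> \<Omega> \<Longrightarrow> g z = gradient f z"
    and cont: "continuous_on (closure \<Omega>) f"
    and diff: "\<And>z. z \<in> \<Omega> \<Longrightarrow> f differentiable (at z)"
    using f by (auto simp: C1_on_closure_def)
  \<comment> \<open>Nontriviality of the filter makes the limit unique, so that \<open>Lim\<close>
    in \<open>normal_derivative\<close> is the actual value \<open>g x\<close>.\<close>
  have "x islimpt \<Omega>" using cl \<open>x \<notin> \<Omega>\<close> by (auto simp: closure_def)
  then have nontriv: "at x within \<Omega> \<noteq> bot" by (simp add: trivial_limit_within)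
  have "(g \<longlongrightarrow> g x) (at x within \<Omega>)"
    using g(1) cl closure_subset by (meson continuous_on tendsto_within_subset)
  then have lim: "(gradient f \<longlongrightarrow> g x) (at x within \<Omega>)"
    using g(2) by (auto elim!: Lim_transform_eventually simp: eventually_at_filter)
  then have "g x \<bullet> \<nu> x = 0"
    using assms(4) tendsto_Lim[OF nontriv lim] by (simp add: normal_derivative_def)
  then have "((\<lambda>z. gradient f z \<bullet> \<nu> x) \<longlongrightarrow> 0) (at x within \<Omega>)"
    using tendsto_inner[OF lim tendsto_const] by metis
  from order_tendstoD(2)[OF this \<open>k > 0\<close>] obtain d where d: "d > 0"
    "\<And>z. z \<in> \<Omega> \<Longrightarrow> z \<noteq> x \<Longrightarrow> dist z x < d \<Longrightarrow> gradient f z \<bullet> \<nu> x < k"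
    by (auto simp: eventually_at)
  define t where "t = min s d / 2"
  have t: "0 < t" "t < s" "t < d" using \<open>s > 0\<close> d(1) by (auto simp: t_def)
  have der: "((\<lambda>t. f (x + t *\<^sub>R - \<nu> x)) has_real_derivative
      gradient f (x - q *\<^sub>R \<nu> x) \<bullet> - \<nu> x) (at q)" if "0 < q" "q < s" for q
    using has_real_derivative_along_line[of f x q "- \<nu> x"] diff[OF inside[OF that]] by simp
  \<comment> \<open>The endpoint 0 is the boundary point \<open>x\<close>, where only continuity on
    the closure is at hand; differentiability holds at the interior times.\<close>
  have "continuous_on {0..t} (\<lambda>t. f (x + t *\<^sub>R - \<nu> x))"
  proof (rule continuous_on_compose2[OF cont])
    show "(\<lambda>t. x + t *\<^sub>R - \<nu> x) ` {0..t} \<subseteq> closure \<Omega>"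
    proof clarify
      fix q assume "q \<in> {0..t}"
      then show "x + q *\<^sub>R - \<nu> x \<in> closure \<Omega>"
        using cl inside[of q] t closure_subset[of \<Omega>] by (cases "q = 0") auto
    qed
  qed (intro continuous_intros)
  then obtain l q where q: "0 < q" "q < t"
      "((\<lambda>t. f (x + t *\<^sub>R - \<nu> x)) has_real_derivative l) (at q)"
      "f (x + t *\<^sub>R - \<nu> x) - f (x + 0 *\<^sub>R - \<nu> x) = (t - 0) * l"
    using MVT[OF t(1), of "\<lambda>t. f (x + t *\<^sub>R - \<nu> x)"] der t real_differentiable_def
    by (smt (verit) less_trans)
  have "l = - (gradient f (x - q *\<^sub>R \<nu> x) \<bullet> \<nu> x)"
    using DERIV_unique[OF q(3) der[of q]] q t by simp
  moreover have "gradient f (x - q *\<^sub>R \<nu> x) \<bullet> \<nu> x < k"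
    using inside[of q] q t norm \<open>x \<notin> \<Omega>\<close> by (intro d(2)) (auto simp: dist_norm)
  ultimately have "t * (- k) < t * l" using t by (intro mult_strict_left_mono) auto
  then show False using decrease[of t] q(4) t by (simp add: mult.commute)
qed

section \<open>The bound for one component\<close>

lemma partial_deriv_quadratic:
  assumes "u differentiable (at x)"
  shows "partial_deriv b (\<lambda>y. (d + a * u y) * u y) x = (d + 2 * a * u x) * partial_deriv b u x"
proof -
  have "(u has_derivative frechet_derivative u (at x)) (at x)"
    using assms by (simp add: frechet_derivative_works)
  then have "((\<lambda>y. (d + a * u y) * u y) has_derivative
      (\<lambda>h. (d + 2 * a * u x) * frechet_derivative u (at x) h)) (at x)"
    by (auto intro!: derivative_eq_intros simp: algebra_simps)
  then show ?thesis
    unfolding partial_deriv_def by (metis frechet_derivative_at)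
qed

text \<open>Stated for one equation so that exchanging the roles of the two species gives both
  bounds. The other species enters through its sign: \<open>v \<ge> 0\<close> turns the equation
  into a lower bound for the Laplacian of \<open>w\<close>.\<close>

lemma steady_state_le_one:
  fixes \<Omega> :: "'a::euclidean_space set"
    and u v :: "'a \<Rightarrow> real"
  assumes dom: "bounded_domain \<Omega>"
    and ball: "\<forall>x\<in>frontier \<Omega>. interior_ball_condition \<Omega> x"
    and normal: "\<forall>x\<in>frontier \<Omega>. outward_unit_normal \<Omega> x (\<nu> x)"
    and const: "a1 > 0" "d > 0" "a \<ge> 0"
    and u: "C1_on_closure \<Omega> u" "Ck_on 2 \<Omega> u"
    and nonneg: "\<forall>x\<in>closure \<Omega>. u x \<ge> 0" "\<forall>x\<in>closure \<Omega>. v x \<ge> 0"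
    and eq: "\<forall>x\<in>\<Omega>. laplacian (\<lambda>y. (d + a * u y) * u y) x + u x * (1 - u x - a1 * v x) = 0"
    and neumann: "\<forall>x\<in>frontier \<Omega>. normal_derivative \<Omega> \<nu> u x = 0"
    and "z \<in> closure \<Omega>"
  shows "u z \<le> 1"
proof (rule ccontr)
  assume "\<not> u z \<le> 1"
  define w where "w y = (d + a * u y) * u y" for y
  have "open \<Omega>" "bounded \<Omega>" using dom by (auto simp: bounded_domain_def)
  have cont: "continuous_on (closure \<Omega>) u" using u by (simp add: C1_on_closure_def)
  obtain x where x: "x \<in> closure \<Omega>" "\<And>y. y \<in> closure \<Omega> \<Longrightarrow> u y \<le> u x"
    using continuous_attains_sup[OF _ _ cont] \<open>bounded \<Omega>\<close> \<open>z \<in> closure \<Omega>\<close>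
    by (metis compact_closure empty_iff)
  have "u x > 1" using x(2)[OF \<open>z \<in> closure \<Omega>\<close>] \<open>\<not> u z \<le> 1\<close> by simp
  have sub: "\<And>y. y \<in> \<Omega> \<Longrightarrow> y \<in> closure \<Omega>" using closure_subset by blast
  \<comment> \<open>This factorisation transfers estimates between \<open>u\<close> and
    \<open>w\<close>: a nonnegative second factor puts the maximum of \<open>w\<close> at
    \<open>x\<close> too, and an upper bound on it later turns a decrease of \<open>w\<close> into
    one of \<open>u\<close>.\<close>
  have wdiff: "w x - w y = (u x - u y) * (d + a * (u x + u y))" for y
    by (simp add: w_def algebra_simps)
  have wmax: "w y \<le> w x" if "y \<in> closure \<Omega>" for y
    using wdiff[of y] x(2)[OF that] nonneg(1) x(1) that const
    by (smt (verit) mult_nonneg_nonneg)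
  have wcont: "continuous_on (closure \<Omega>) w"
    unfolding w_def by (intro continuous_intros cont)
  have udiff: "u differentiable (at y)" if "y \<in> \<Omega>" for y
    using u(2) that by (simp add: numeral_2_eq_2)
  have wD: "w differentiable (at y)" if "y \<in> \<Omega>" for y
    unfolding w_def using udiff[OF that] by (intro derivative_intros) auto
  have wD2: "partial_deriv b w differentiable (at y)" if "y \<in> \<Omega>" "b \<in> Basis" for y b
  proof -
    have "partial_deriv b u differentiable (at y)"
      using u(2) that by (simp add: numeral_2_eq_2)
    then have "(\<lambda>p. (d + 2 * a * u p) * partial_deriv b u p) differentiable (at y)"
      using udiff[OF that(1)] by (intro derivative_intros) auto
    then obtain D where "((\<lambda>p. (d + 2 * a * u p) * partial_deriv b u p) has_derivative D) (at y)"
      by (auto simp: differentiable_def)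
    then have "(partial_deriv b w has_derivative D) (at y)"
      using \<open>open \<Omega>\<close> \<open>y \<in> \<Omega>\<close>
      by (rule has_derivative_transform_within_open)
        (auto simp: w_def[abs_def] partial_deriv_quadratic[OF udiff])
    then show ?thesis by (auto simp: differentiable_def)
  qed
  have lap: "laplacian w y \<ge> u y * (u y - 1)" if "y \<in> \<Omega>" for y
  proof -
    have "laplacian w y = u y * (u y - 1) + u y * (a1 * v y)"
      using eq that by (simp add: w_def[abs_def] algebra_simps)
    moreover have "u y * (a1 * v y) \<ge> 0"
      using nonneg sub[OF that] const by (intro mult_nonneg_nonneg) auto
    ultimately show ?thesis by simp
  qed
  have "x \<notin> \<Omega>"
  proof
    assume "x \<in> \<Omega>"
    \<comment> \<open>The paraboloid comparison with coefficient 0 is the plain maximum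
      test.\<close>
    then have "laplacian w x \<le> 2 * 0 * real DIM('a)"
      using wD wD2 wmax sub
      by (intro laplacian_le_at_max_minus_paraboloid[OF \<open>open \<Omega>\<close>, where y = x]) auto
    moreover have "u x * (u x - 1) > 0" using \<open>u x > 1\<close> by simp
    ultimately show False using lap[OF \<open>x \<in> \<Omega>\<close>] by simp
  qed
  then have xf: "x \<in> frontier \<Omega>" using x(1) \<open>open \<Omega>\<close> by (simp add: frontier_def interior_open)
  then obtain y r where yr: "0 < r" "ball y r \<subseteq> \<Omega>" "x \<in> sphere y r"
    using ball unfolding interior_ball_condition_def by blast
  have e: "x - y = r *\<^sub>R \<nu> x"
    using outward_unit_normal_interior_ball[OF _ xf yr] normal xf by blast
  have "norm (x - y) = r" using yr by (simp add: dist_norm norm_minus_commute)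
  with e yr(1) have norm\<nu>: "norm (\<nu> x) = 1" by simp
  \<comment> \<open>Any level strictly between 1 and \<open>u x\<close> would do: near
    \<open>x\<close>, \<open>u\<close> exceeds \<open>m\<close>, so the Laplacian of
    \<open>w\<close> is at least the fixed positive number \<open>m * (m - 1)\<close>.\<close>
  define m where "m = (1 + u x) / 2"
  have m: "1 < m" "m < u x" using \<open>u x > 1\<close> by (auto simp: m_def)
  have "(u \<longlongrightarrow> u x) (at x within closure \<Omega>)"
    using cont x(1) by (simp add: continuous_on)
  from order_tendstoD(1)[OF this m(2)] obtain \<delta> where \<delta>: "\<delta> > 0"
    "\<And>p. p \<in> closure \<Omega> \<Longrightarrow> p \<noteq> x \<Longrightarrow> dist p x < \<delta> \<Longrightarrow> m < u p"
    by (auto simp: eventually_at)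
  \<comment> \<open>The divisor 3 gives both \<open>s < r\<close> and
    \<open>2 * s < \<delta>\<close>: a ball of radius \<open>s\<close> touching \<open>x\<close> has
    diameter \<open>2 * s\<close>, so all of it is within \<delta> of \<open>x\<close>.\<close>
  define s where "s = min r \<delta> / 3"
  have s: "0 < s" "s < r" "2 * s < \<delta>" using yr(1) \<delta>(1) by (auto simp: s_def)
  \<comment> \<open>The centre moves along the normal so that the smaller ball lies inside the old
    one and still touches the boundary at \<open>x\<close>.\<close>
  define y' where "y' = x - s *\<^sub>R \<nu> x"
  have "y - y' = (s - r) *\<^sub>R \<nu> x" using e by (simp add: y'_def algebra_simps)
  then have "dist y y' = r - s" using s norm\<nu> by (simp add: dist_norm)
  then have inball: "ball y' s \<subseteq> \<Omega>"
    using yr(2) ball_subset_ball_iff[of y' s y r] by (auto simp: dist_commute)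
  then have incball: "cball y' s \<subseteq> closure \<Omega>"
    using closure_mono[OF inball] s by (simp add: closure_ball)
  have "dist y' x = s" using s norm\<nu> by (simp add: y'_def dist_norm)
  \<comment> \<open>The 4 makes \<open>2 * k * DIM('a)\<close> half of \<open>m * (m - 1)\<close>,
    which gives the strict inequality required by the comparison.\<close>
  define k where "k = m * (m - 1) / (4 * DIM('a))"
  have mm: "m * (m - 1) > 0" using m by simp
  then have "k > 0" by (simp add: k_def)
  have k: "2 * k * real DIM('a) < m * (m - 1)"
    using mm by (simp add: k_def)
  have lap_ball: "2 * k * real DIM('a) < laplacian w p" if "p \<in> ball y' s" for p
  proof -
    have "dist p x < \<delta>"
      using that s \<open>dist y' x = s\<close> dist_triangle[of p x y'] by (simp add: dist_commute)
    then have "m < u p" using \<delta>(2)[of p] that inball sub \<open>x \<notin> \<Omega>\<close> by blast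
    then have "m * (m - 1) \<le> u p * (u p - 1)" using m by (intro mult_mono) auto
    also have "\<dots> \<le> laplacian w p" using lap that inball by blast
    finally show ?thesis using k by simp
  qed
  \<comment> \<open>The bound on the sphere is the global maximum \<open>w x\<close>, so the
    paraboloid meets \<open>w\<close> at \<open>x\<close> itself.\<close>
  have para: "w p \<le> w x - k * (s\<^sup>2 - (dist p y')\<^sup>2)" if "p \<in> cball y' s" for p
    using inball incball wD wD2 wmax lap_ball that
    by (intro paraboloid_bound_on_ball[of y' s w k]) (auto intro: continuous_on_subset[OF wcont])
  \<comment> \<open>\<open>L\<close> bounds the second factor in \<open>wdiff\<close>, since
    \<open>u \<le> u x\<close> on the closure.\<close>
  define L where "L = d + a * (2 * u x)"
  have "L > 0" using const \<open>u x > 1\<close> by (simp add: L_def add_pos_nonneg)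
  show False
  proof (rule no_linear_decrease_along_normal[where \<nu> = \<nu>, OF \<open>open \<Omega>\<close> xf u(1) _ norm\<nu> \<open>s > 0\<close>])
    show "normal_derivative \<Omega> \<nu> u x = 0" using neumann xf by blast
    show "k * s / L > 0" using \<open>k > 0\<close> \<open>s > 0\<close> \<open>L > 0\<close> by simp
    fix t assume t: "0 < t" "t < s"
    have "x - t *\<^sub>R \<nu> x - y' = (s - t) *\<^sub>R \<nu> x" by (simp add: y'_def algebra_simps)
    then have dist: "dist (x - t *\<^sub>R \<nu> x) y' = s - t" using t norm\<nu> by (simp add: dist_norm)
    then have "x - t *\<^sub>R \<nu> x \<in> ball y' s" using t by (simp add: dist_commute)
    then show inO: "x - t *\<^sub>R \<nu> x \<in> \<Omega>" using inball by blast
    \<comment> \<open>The difference of squares is \<open>t * (2 * s - t)\<close>, and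
      \<open>t < s\<close> leaves at least \<open>s * t\<close>: a decrease linear in
      \<open>t\<close>.\<close>
    have "k * (s * t) \<le> k * (s\<^sup>2 - (s - t)\<^sup>2)"
      using t \<open>k > 0\<close> by (intro mult_left_mono) (auto simp: power2_eq_square algebra_simps)
    also have "\<dots> \<le> w x - w (x - t *\<^sub>R \<nu> x)"
      using para[of "x - t *\<^sub>R \<nu> x"] dist t by (simp add: dist_commute)
    also have "\<dots> \<le> (u x - u (x - t *\<^sub>R \<nu> x)) * L"
      unfolding wdiff L_def using x(2)[OF sub[OF inO]] const
      by (intro mult_left_mono add_left_mono) auto
    finally show "k * s / L * t \<le> u x - u (x - t *\<^sub>R \<nu> x)"
      using \<open>L > 0\<close> by (simp add: pos_divide_le_eq mult.assoc)
  qed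
qed

theorem lemma3p1:
  fixes \<Omega> :: "'a::euclidean_space set"
    and \<nu> :: "'a \<Rightarrow> 'a"
    and u v :: "'a \<Rightarrow> real"
    and a1 a2 d1 d2 a11 a22 :: real
  assumes "bounded_domain \<Omega>"
    and "smooth_boundary \<Omega>"
    and "\<forall>x\<in>frontier \<Omega>. interior_ball_condition \<Omega> x"
    and "\<forall>x\<in>frontier \<Omega>. outward_unit_normal \<Omega> x (\<nu> x)"
    and "a1 > 0" "a2 > 0" "d1 > 0" "d2 > 0" "a11 \<ge> 0" "a22 \<ge> 0"
    and "C1_on_closure \<Omega> u" "Ck_on 2 \<Omega> u"
    and "C1_on_closure \<Omega> v" "Ck_on 2 \<Omega> v"
    and "\<forall>x\<in>closure \<Omega>. u x \<ge> 0" "\<forall>x\<in>closure \<Omega>. v x \<ge> 0"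
    and "\<forall>x\<in>\<Omega>. laplacian (\<lambda>y. (d1 + a11 * u y) * u y) x + u x * (1 - u x - a1 * v x) = 0"
    and "\<forall>x\<in>\<Omega>. laplacian (\<lambda>y. (d2 + a22 * v y) * v y) x + v x * (1 - a2 * u x - v x) = 0"
    and "\<forall>x\<in>frontier \<Omega>. normal_derivative \<Omega> \<nu> u x = 0"
    and "\<forall>x\<in>frontier \<Omega>. normal_derivative \<Omega> \<nu> v x = 0"
  shows "((\<exists>x\<in>closure \<Omega>. u x \<noteq> 0) \<longrightarrow> (\<forall>x\<in>closure \<Omega>. u x \<le> 1)) \<and>
         ((\<exists>x\<in>closure \<Omega>. v x \<noteq> 0) \<longrightarrow> (\<forall>x\<in>closure \<Omega>. v x \<le> 1))"
proof -
  \<comment> \<open>Reordering the reaction term puts the second equation in the form of the first,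
    with \<open>u\<close> and \<open>v\<close> exchanged.\<close>
  have "\<forall>x\<in>\<Omega>. laplacian (\<lambda>y. (d2 + a22 * v y) * v y) x + v x * (1 - v x - a2 * u x) = 0"
    using assms(18) by (simp add: algebra_simps)
  then have "v x \<le> 1" if "x \<in> closure \<Omega>" for x
    using steady_state_le_one[of \<Omega> \<nu> a2 d2 a22 v u] assms that by blast
  moreover have "u x \<le> 1" if "x \<in> closure \<Omega>" for x
    using steady_state_le_one[of \<Omega> \<nu> a1 d1 a11 u v] assms that by blast
  ultimately show ?thesis by blast
qed

end
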